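(* Let $0<q<1$ and $\kappa\in\mathbf i\mathbb R_{>0}$. The functions $\mathcal F_n(x)$, $n\in\frac12\mathbb Z_{\ge0}$, defined by $$\mathcal F_n(x)=\sqrt{1-\kappa^{-2}q^{-2x}}\sum_{i=-n}^{n}\frac{(-1)^{n+i}q^{-i/2}}{(q;q)_{n-i}(q;q)_{n+i}}\,\frac1{\theta_{\sqrt q}\bigl(|\kappa|q^{x+i+\frac12}\bigr)},\qquad x\in\tfrac12\mathbb Z,$$ are orthogonal in the variable $x$ in each of the three spaces $\ell^2(\mathbb Z)$, $\ell^2(\mathbb Z+\frac12)$, and $\ell^2(\frac12\mathbb Z)$.
   Context: $\theta_p(z)=(z;p)_\infty(p/z;p)_\infty$, where $(a;p)_k=\prod_{j=0}^{k-1}(1-ap^j)$. $\frac12\mathbb Z$ is the set of all integers and half-integers. The sum over $i$ in $\mathcal F_n$ runs only over those $i\in\frac12\mathbb Z$ with $-n\le i\le n$ and $n-i\in\mathbb Z$. Note $-\kappa^{-2}>0$, so the square root is of a positive number. In each of the three spaces, $n$ ranges over all of $\frac12\mathbb Z_{\ge0}$. *)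

theory Defs
  imports "HOL-Analysis.Analysis"
begin

definition qpoch :: "'a::real_normed_field \<Rightarrow> 'a \<Rightarrow> nat \<Rightarrow> 'a" where
  "qpoch a p k = (\<Prod>j<k. 1 - a * p ^ j)"

definition qpoch_inf :: "'a::real_normed_field \<Rightarrow> 'a \<Rightarrow> 'a" where
  "qpoch_inf a p = (\<Prod>j. 1 - a * p ^ j)"

definition theta :: "'a::real_normed_field \<Rightarrow> 'a \<Rightarrow> 'a" where
  "theta p z = qpoch_inf z p * qpoch_inf (p / z) p"

definition half_ints :: "real set" where
  "half_ints = {x. 2 * x \<in> \<int>}"

definition index_range :: "real \<Rightarrow> real set" where
  "index_range n = {i \<in> half_ints. - n \<le> i \<and> i \<le> n \<and> n - i \<in> \<int>}"

lemma finite_index_range: "finite (index_range n)"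
proof -
  have "index_range n \<subseteq> (\<lambda>k. n - of_int k) ` {0..\<lfloor>2 * n\<rfloor>}"
  proof
    fix i assume i: "i \<in> index_range n"
    then obtain k where k: "n - i = of_int k"
      by (auto simp: index_range_def elim: Ints_cases)
    have "0 \<le> real_of_int k" "real_of_int k \<le> 2 * n"
      using i k by (auto simp: index_range_def)
    then have "k \<in> {0..\<lfloor>2 * n\<rfloor>}" by (simp add: le_floor_iff)
    moreover have "i = n - of_int k" using k by simp
    ultimately show "i \<in> (\<lambda>k. n - of_int k) ` {0..\<lfloor>2 * n\<rfloor>}" by blast
  qed
  then show ?thesis by (rule finite_subset) simp
qed

text \<open>The functions are used for \<open>n \<in> half_ints\<close> with \<open>n \<ge> 0\<close>; then \<open>n - i\<close> and \<open>n + i\<close> are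
  nonnegative integers for every \<open>i \<in> index_range n\<close>, so the floors below are exact.
  When \<open>kappa\<close> is a positive multiple of \<open>\<i>\<close>, the argument of \<open>csqrt\<close> is a positive real and
  \<open>csqrt\<close> is its positive square root.
  If \<open>cmod kappa\<close> is an integer power of \<open>sqrt q\<close>, all the theta values that occur for
  \<open>x \<in> half_ints\<close> vanish, and by \<open>1 / 0 = 0\<close> the function is zero on \<open>half_ints\<close>.\<close>

definition F_fun :: "real \<Rightarrow> complex \<Rightarrow> real \<Rightarrow> real \<Rightarrow> complex" where
  "F_fun q kappa n x =
     csqrt (1 - kappa powi (-2) * complex_of_real (q powr (- 2 * x))) *
     complex_of_real (\<Sum>i\<in>index_range n.
       (-1) powi \<lfloor>n + i\<rfloor> * q powr (- i / 2) /
         (qpoch q q (nat \<lfloor>n - i\<rfloor>) * qpoch q q (nat \<lfloor>n + i\<rfloor>)) *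
       (1 / theta (sqrt q) (cmod kappa * q powr (x + i + 1 / 2))))"

definition ell2 :: "'a set \<Rightarrow> ('a \<Rightarrow> complex) set" where
  "ell2 S = {f. (\<lambda>x. (cmod (f x))\<^sup>2) summable_on S}"

definition ell2_inner :: "'a set \<Rightarrow> ('a \<Rightarrow> complex) \<Rightarrow> ('a \<Rightarrow> complex) \<Rightarrow> complex" where
  "ell2_inner S f g = (\<Sum>\<^sub>\<infinity>x\<in>S. f x * cnj (g x))"

definition orthogonal_family_ell2 :: "'a set \<Rightarrow> 'b set \<Rightarrow> ('b \<Rightarrow> 'a \<Rightarrow> complex) \<Rightarrow> bool" where
  "orthogonal_family_ell2 S I f \<longleftrightarrow>
     (\<forall>n\<in>I. f n \<in> ell2 S) \<and>
     (\<forall>m\<in>I. \<forall>n\<in>I. m \<noteq> n \<longrightarrow> ell2_inner S (f m) (f n) = 0)"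

end

theory Submission
  imports Defs
begin

text \<open>
  Put \<open>z = \<bar>\<kappa>\<bar> q\<^sup>x\<close> and \<open>N = 2 n\<close>. Quasi-periodicity of \<open>\<theta>\<close> turns \<open>F\<^sub>n(x)\<close> into a constant times
  \<open>sqrt (1 + z\<^sup>-\<^sup>2) z P\<^sub>N(z) / \<theta>(z)\<close>, where \<open>P\<^sub>N\<close> is Askey's \<open>q\<^sup>-\<^sup>1\<close>-Hermite polynomial of degree \<open>N\<close>
  in \<open>(1 / z - z) / 2\<close>. On a coset \<open>a + \<int>\<close> the squared prefactor is a discrete solution of the
  (indeterminate) \<open>q\<^sup>-\<^sup>1\<close>-Hermite moment problem: by a raising relation, weight times \<open>P\<^sub>N\<close> is a
  difference \<open>H\<^sub>j - H\<^sub>j\<^sub>+\<^sub>1\<close> for \<open>N \<ge> 1\<close>, so its sum telescopes to \<open>0\<close>, and the three-term recurrence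
  extends this to orthogonality. The lattice of half-integers is the union of two cosets.
\<close>

section \<open>Coefficient identities for the \<open>q\<close>-inverse Hermite polynomials\<close>

text \<open>The value \<open>0\<close> at negative \<open>k\<close> makes the recurrences below hold for all integer indices,
  without boundary cases.\<close>
definition qfac_inv :: "real \<Rightarrow> int \<Rightarrow> real" where
  "qfac_inv q k = (if k < 0 then 0 else 1 / qpoch q q (nat k))"

lemma qpoch_pos:
  fixes q :: real
  assumes "0 < q" "q < 1"
  shows "qpoch q q k > 0"
  unfolding qpoch_def
proof (rule prod_pos, clarify)
  fix j
  have "q ^ Suc j < 1" using assms by (intro power_Suc_less_one) auto
  then show "0 < 1 - q * q ^ j" by simp
qed

text \<open>The last factor of \<open>(q;q)_k\<close> is \<open>1 - q powi k\<close>. At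
  \<open>k = 0\<close> this factor vanishes, in agreement with the value \<open>0\<close> at
  \<open>-1\<close>, so later uses need no boundary cases.\<close>

lemma qfac_inv_minus_one:
  fixes q :: real
  assumes "0 < q" "q < 1"
  shows "qfac_inv q (k - 1) = (1 - q powi k) * qfac_inv q k"
proof (cases "k \<le> 0")
  case True
  then show ?thesis by (cases "k = 0") (auto simp: qfac_inv_def)
next
  case False
  define m where "m = nat (k - 1)"
  have k: "k = int (Suc m)" using False by (simp add: m_def)
  have "qpoch q q (Suc m) = qpoch q q m * (1 - q ^ Suc m)"
    by (simp add: qpoch_def)
  moreover have "qpoch q q m > 0" "qpoch q q (Suc m) > 0" using qpoch_pos[OF assms] by auto
  moreover have "nat (1 + int m) = Suc m" "q powi (1 + int m) = q ^ Suc m"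
    using assms by (simp_all add: power_int_add)
  moreover have "q * q ^ m \<noteq> 1"
    using power_Suc_less_one[of q m] assms by simp
  ultimately show ?thesis
    unfolding k qfac_inv_def by (simp add: divide_simps)
qed

definition hcoef :: "real \<Rightarrow> int \<Rightarrow> int \<Rightarrow> real" where
  "hcoef q N k = (-1) powi k * q powi (k * (k - N)) * qfac_inv q k * qfac_inv q (N - k)"

text \<open>This is Askey's polynomial \<open>h_N(x | q)\<close> divided by \<open>(q;q)_N\<close>,
  with x = sinh \<xi> and z = exp(-\<xi>). For negative \<open>N\<close> the range is empty and the
  value is \<open>0\<close>, as the three-term recurrence at \<open>N = 0\<close> requires.\<close>

definition hpoly :: "real \<Rightarrow> int \<Rightarrow> real \<Rightarrow> real" where
  "hpoly q N z = (\<Sum>k\<in>{0..N}. hcoef q N k * z powi (2 * k - N))"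

lemma hcoef_eq_0: "k \<notin> {0..N} \<Longrightarrow> hcoef q N k = 0"
  by (auto simp: hcoef_def qfac_inv_def)

text \<open>Because the coefficients vanish outside \<open>{0..N}\<close>, sums over shifted indices
  can all be written over one large range \<open>K\<close> and then compared termwise. The bounds
  \<open>a\<close> and \<open>b\<close> limit the shifts that \<open>K\<close> has to
  accommodate.\<close>

lemma sum_hcoef_eq:
  assumes "finite K" "{a..b + N} \<subseteq> K" "a \<le> s" "s \<le> b"
  shows "(\<Sum>k\<in>{0..N}. hcoef q N k * f k) = (\<Sum>k\<in>K. hcoef q N (k - s) * f (k - s))"
proof -
  have "(\<Sum>k\<in>{0..N}. hcoef q N k * f k) = (\<Sum>k\<in>{s..s + N}. hcoef q N (k - s) * f (k - s))"
    by (rule sum.reindex_bij_witness[of _ "\<lambda>k. k - s" "\<lambda>k. k + s"]) auto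
  also have "\<dots> = (\<Sum>k\<in>K. hcoef q N (k - s) * f (k - s))"
    using assms by (intro sum.mono_neutral_left) (auto simp: hcoef_eq_0)
  finally show ?thesis .
qed

text \<open>The coefficient of \<open>z powi (2 * k - N)\<close> in \<open>hpoly_raising\<close>.
  After common factors are pulled out, what remains is a rational identity in \<open>q\<close>,
  \<open>a = q powi k\<close> and \<open>b = q powi N\<close>.\<close>

lemma hcoef_raising:
  assumes "0 < q" "q < 1"
  shows "(1 - q powi N) * (hcoef q N k + hcoef q N (k - 1)) =
    q powi (-k) * hcoef q (N - 1) k - q powi (k - 1 - N) * hcoef q (N - 1) (k - 2)"
proof -
  define a b X where "a = q powi k" and "b = q powi N" and "X = q powi (k * (k - N))"
  \<comment> \<open>\<open>E\<close> and \<open>E'\<close> have the largest indices that occur;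
    every other reciprocal factorial is a multiple of one of them by
    \<open>qfac_inv_minus_one\<close>.\<close>
  define E E' s :: real where "E = qfac_inv q k" and "E' = qfac_inv q (N - k + 1)" and "s = (-1) powi k"
  have q: "q \<noteq> 0" and a: "a \<noteq> 0" and b: "b \<noteq> 0" using assms by (auto simp: a_def b_def)
  have dbl: "q powi (2 * k) = (q powi k)\<^sup>2" "q powi (3 * k) = (q powi k) ^ 3" "q powi (2 * N) = (q powi N)\<^sup>2"
    using power_int_mult[of q k 2] power_int_mult[of q k 3] power_int_mult[of q N 2]
    by (simp_all add: mult.commute)
  note rec = qfac_inv_minus_one[OF assms]
  have e1: "qfac_inv q (k - 1) = (1 - a) * E" by (simp add: rec a_def E_def)
  have "qfac_inv q (k - 2) = (1 - q powi (k - 1)) * qfac_inv q (k - 1)"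
    using rec[of "k - 1"] by simp
  then have e2: "qfac_inv q (k - 2) = (1 - a / q) * ((1 - a) * E)"
    using q by (simp add: e1 a_def power_int_diff)
  have "qfac_inv q (N - k) = (1 - q powi (N - k + 1)) * E'"
    using rec[of "N - k + 1"] by (simp add: E'_def)
  then have e3: "qfac_inv q (N - k) = (1 - q * b / a) * E'"
    using q by (simp add: a_def b_def power_int_diff power_int_add)
  have "qfac_inv q (N - 1 - k) = (1 - q powi (N - k)) * qfac_inv q (N - k)"
    using rec[of "N - k"] by (simp add: algebra_simps)
  then have e4: "qfac_inv q (N - 1 - k) = (1 - b / a) * ((1 - q * b / a) * E')"
    using q by (simp add: e3 a_def b_def power_int_diff)
  have p1: "q powi ((k - 1) * (k - 1 - N)) = X * q * b / a ^ 2"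
  proof -
    have "(k - 1) * (k - 1 - N) = k * (k - N) + 1 + N - 2 * k" by (simp add: algebra_simps)
    then show ?thesis using q
      by (simp add: X_def a_def b_def power_int_diff power_int_add dbl)
  qed
  have p2: "q powi (k * (k - (N - 1))) = X * a"
  proof -
    have "k * (k - (N - 1)) = k * (k - N) + k" by (simp add: algebra_simps)
    then show ?thesis using q by (simp add: X_def a_def power_int_add)
  qed
  have p3: "q powi ((k - 2) * (k - 2 - (N - 1))) = X * q ^ 2 * b ^ 2 / a ^ 3"
  proof -
    have "(k - 2) * (k - 2 - (N - 1)) = k * (k - N) + 2 + 2 * N - 3 * k" by (simp add: algebra_simps)
    then show ?thesis using q
      by (simp add: X_def a_def b_def power_int_diff power_int_add dbl)
  qed
  have s1: "(-1) powi (k - 1) = - s" and s2: "(-1) powi (k - 2) = s"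
    by (simp_all add: s_def power_int_diff)
  have r1: "N - (k - 1) = N - k + 1" and r2: "N - 1 - (k - 2) = N - k + 1" by simp_all
  have p4: "q powi (-k) = 1 / a" "q powi (k - 1 - N) = a / (q * b)"
    using q by (simp_all add: a_def b_def power_int_diff power_int_minus inverse_eq_divide)
  show ?thesis
    unfolding hcoef_def r1 r2 e1 e2 e3 e4 p1 p2 p3 p4 s1 s2
      E_def[symmetric] E'_def[symmetric] s_def[symmetric] X_def[symmetric] b_def[symmetric]
    using q a b by (simp add: field_simps power2_eq_square power3_eq_cube)
qed

text \<open>The coefficient of \<open>z powi (2 * k - N - 1)\<close> in
  \<open>hpoly_three_term\<close>, reduced to a rational identity by the same normalisation as in
  \<open>hcoef_raising\<close>.\<close>

lemma hcoef_three_term: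
  assumes "0 < q" "q < 1"
  shows "hcoef q N k - hcoef q N (k - 1) =
    (1 - q powi (N + 1)) * hcoef q (N + 1) k + q powi (-N) * hcoef q (N - 1) (k - 1)"
proof -
  define a b X where "a = q powi k" and "b = q powi N" and "X = q powi (k * (k - N))"
  define E E' s :: real where "E = qfac_inv q k" and "E' = qfac_inv q (N - k + 1)" and "s = (-1) powi k"
  have q: "q \<noteq> 0" and a: "a \<noteq> 0" and b: "b \<noteq> 0" using assms by (auto simp: a_def b_def)
  have dbl: "q powi (2 * k) = (q powi k)\<^sup>2"
    using power_int_mult[of q k 2] by (simp add: mult.commute)
  note rec = qfac_inv_minus_one[OF assms]
  have e1: "qfac_inv q (k - 1) = (1 - a) * E" by (simp add: rec a_def E_def)
  have "qfac_inv q (N - k) = (1 - q powi (N - k + 1)) * E'"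
    using rec[of "N - k + 1"] by (simp add: E'_def)
  then have e3: "qfac_inv q (N - k) = (1 - q * b / a) * E'"
    using q by (simp add: a_def b_def power_int_diff power_int_add)
  have p1: "q powi ((k - 1) * (k - 1 - N)) = X * q * b / a ^ 2"
  proof -
    have "(k - 1) * (k - 1 - N) = k * (k - N) + 1 + N - 2 * k" by (simp add: algebra_simps)
    then show ?thesis using q
      by (simp add: X_def a_def b_def power_int_diff power_int_add dbl)
  qed
  have p2: "q powi (k * (k - (N + 1))) = X / a"
  proof -
    have "k * (k - (N + 1)) = k * (k - N) - k" by (simp add: algebra_simps)
    then show ?thesis using q by (simp add: X_def a_def power_int_diff)
  qed
  have p3: "q powi ((k - 1) * (k - 1 - (N - 1))) = X * b / a"
  proof -
    have "(k - 1) * (k - 1 - (N - 1)) = k * (k - N) + N - k" by (simp add: algebra_simps)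
    then show ?thesis using q
      by (simp add: X_def a_def b_def power_int_diff power_int_add)
  qed
  have s1: "(-1) powi (k - 1) = - s"
    by (simp add: s_def power_int_diff)
  have r1: "N - (k - 1) = N - k + 1" and r2: "N + 1 - k = N - k + 1" and r3: "N - 1 - (k - 1) = N - k"
    by simp_all
  have p4: "q powi (-N) = 1 / b" "q powi (N + 1) = q * b"
    using q by (simp_all add: b_def power_int_add power_int_minus inverse_eq_divide)
  show ?thesis
    unfolding hcoef_def r1 r2 r3 e1 e3 p1 p2 p3 p4 s1
      E_def[symmetric] E'_def[symmetric] s_def[symmetric] X_def[symmetric]
    using q a b by (simp add: field_simps power2_eq_square)
qed

lemma hpoly_three_term:
  assumes q: "0 < q" "q < 1" and z: "z \<noteq> 0"
  shows "(1 / z - z) * hpoly q N z =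
    (1 - q powi (N + 1)) * hpoly q (N + 1) z + q powi (-N) * hpoly q (N - 1) z"
proof -
  \<comment> \<open>Large enough for degree \<open>N + 1\<close> with shifts up to
    \<open>1\<close>.\<close>
  define K where "K = {-1..N + 2}"
  note S = sum_hcoef_eq[where K = K and a = 0 and b = 1]
  have K: "finite K" by (simp add: K_def)
  have e0: "1 / z * (c * z powi (2 * k - N)) = c * z powi (2 * k - N - 1)"
    and e1: "z * (c * z powi (2 * (k - 1) - N)) = c * z powi (2 * k - N - 1)" for c k
    using z power_int_diff[of z "2 * k - N" 1] power_int_add[of z 1 "2 * (k - 1) - N"]
    by (auto simp: algebra_simps)
  have h0: "1 / z * hpoly q N z = (\<Sum>k\<in>K. hcoef q N k * z powi (2 * k - N - 1))"
    unfolding hpoly_def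
    by (subst S[where s = 0]) (use e0 in \<open>auto simp: K_def sum_distrib_left intro!: sum.cong\<close>)
  have h1: "z * hpoly q N z = (\<Sum>k\<in>K. hcoef q N (k - 1) * z powi (2 * k - N - 1))"
    unfolding hpoly_def
    by (subst S[where s = 1]) (use e1 in \<open>auto simp: K_def sum_distrib_left intro!: sum.cong\<close>)
  have h2: "hpoly q (N + 1) z = (\<Sum>k\<in>K. hcoef q (N + 1) k * z powi (2 * k - N - 1))"
    unfolding hpoly_def
    by (subst S[where s = 0]) (auto simp: K_def diff_diff_eq)
  have h3: "hpoly q (N - 1) z = (\<Sum>k\<in>K. hcoef q (N - 1) (k - 1) * z powi (2 * k - N - 1))"
    unfolding hpoly_def
    by (subst S[where s = 1]) (auto simp: K_def algebra_simps intro!: sum.cong)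
  have "(1 / z - z) * hpoly q N z = (\<Sum>k\<in>K. (hcoef q N k - hcoef q N (k - 1)) * z powi (2 * k - N - 1))"
    by (simp only: left_diff_distrib h0 h1 sum_subtractf)
  also have "\<dots> = (\<Sum>k\<in>K. ((1 - q powi (N + 1)) * hcoef q (N + 1) k + q powi (-N) * hcoef q (N - 1) (k - 1))
      * z powi (2 * k - N - 1))"
    by (simp only: hcoef_three_term[OF q])
  also have "\<dots> = (1 - q powi (N + 1)) * hpoly q (N + 1) z + q powi (-N) * hpoly q (N - 1) z"
    by (simp only: h2 h3 distrib_right sum.distrib sum_distrib_left mult.assoc)
  finally show ?thesis .
qed

text \<open>For \<open>q > 0\<close> and nonzero \<open>z\<close> this is
  \<open>q powr ((1 - N) / 2) * hpoly q (N - 1) (z / sqrt q) / z\<close>; the expanded form avoids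
  half-integer powers of \<open>q\<close>.\<close>

definition hraise :: "real \<Rightarrow> int \<Rightarrow> real \<Rightarrow> real" where
  "hraise q N z = (\<Sum>k\<in>{0..N - 1}. hcoef q (N - 1) k * (q powi (-k) * z powi (2 * k - N)))"

text \<open>The factor \<open>q * z ^ 4\<close> is the ratio of consecutive weights at
  \<open>z = t * q powi j\<close> (\<open>vweight_add_one\<close>), so multiplying by the weight
  turns the right-hand side into a difference of neighbouring terms.\<close>

lemma hpoly_raising:
  assumes q: "0 < q" "q < 1" and z: "z \<noteq> 0"
  shows "(1 - q powi N) * ((1 + z\<^sup>2) * hpoly q N z) = hraise q N z - q * z ^ 4 * hraise q N (q * z)"
proof -
  define K where "K = {-1..N + 3}"
  note S = sum_hcoef_eq[where K = K and a = 0 and b = 2]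
  have h0: "hpoly q N z = (\<Sum>k\<in>K. hcoef q N k * z powi (2 * k - N))"
    unfolding hpoly_def by (subst S[where s = 0]) (auto simp: K_def)
  have e1: "z\<^sup>2 * (c * z powi (2 * (k - 1) - N)) = c * z powi (2 * k - N)" for c k
    using z power_int_add[of z 2 "2 * (k - 1) - N"] by (simp add: algebra_simps)
  have h1: "z\<^sup>2 * hpoly q N z = (\<Sum>k\<in>K. hcoef q N (k - 1) * z powi (2 * k - N))"
    unfolding hpoly_def
    by (subst S[where s = 1]) (use e1 in \<open>auto simp: K_def sum_distrib_left intro!: sum.cong\<close>)
  have h2: "hraise q N z = (\<Sum>k\<in>K. hcoef q (N - 1) k * (q powi (-k) * z powi (2 * k - N)))"
    unfolding hraise_def by (subst S[where s = 0]) (auto simp: K_def)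
  \<comment> \<open>The factor \<open>z ^ 4\<close> raises the summation index by two, hence the
    shift \<open>s = 2\<close> below.\<close>
  have e: "q * z ^ 4 * (c * (q powi (-(k - 2)) * (q * z) powi (2 * (k - 2) - N))) =
      c * (q powi (k - 1 - N) * z powi (2 * k - N))" for c k
  proof -
    have "z powi (2 * k - N) = z powi (2 * (k - 2) - N) * z ^ 4"
      using z power_int_add[of z "2 * (k - 2) - N" 4] by simp
    moreover have "q powi (k - 1 - N) = q * q powi (-(k - 2)) * q powi (2 * (k - 2) - N)"
    proof -
      have "k - 1 - N = 1 + (-(k - 2)) + (2 * (k - 2) - N)" by simp
      then show ?thesis using q by (metis power_int_add power_int_1_right less_irrefl)
    qed
    ultimately show ?thesis by (simp add: power_int_mult_distrib)
  qed
  have h3: "q * z ^ 4 * hraise q N (q * z) = (\<Sum>k\<in>K. hcoef q (N - 1) (k - 2) * (q powi (k - 1 - N) * z powi (2 * k - N)))"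
    unfolding hraise_def
    by (subst S[where s = 2]) (use e in \<open>auto simp: K_def sum_distrib_left intro!: sum.cong\<close>)
  have "(1 - q powi N) * ((1 + z\<^sup>2) * hpoly q N z) =
      (\<Sum>k\<in>K. ((1 - q powi N) * (hcoef q N k + hcoef q N (k - 1))) * z powi (2 * k - N))"
  proof -
    have "(1 + z\<^sup>2) * hpoly q N z = hpoly q N z + z\<^sup>2 * hpoly q N z" by (simp add: algebra_simps)
    also have "\<dots> = (\<Sum>k\<in>K. (hcoef q N k + hcoef q N (k - 1)) * z powi (2 * k - N))"
      unfolding h1 unfolding h0 by (simp add: sum.distrib distrib_right)
    finally show ?thesis by (simp add: sum_distrib_left mult.assoc)
  qed
  also have "\<dots> = hraise q N z - q * z ^ 4 * hraise q N (q * z)"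
    unfolding hcoef_raising[OF q] h2 h3 sum_subtractf[symmetric]
    by (intro sum.cong refl) (simp add: algebra_simps)
  finally show ?thesis .
qed

section \<open>Gaussian weights and summability over the integers\<close>

text \<open>Consecutive terms have ratio \<open>c * q ^ (4 * n + 2)\<close>, which tends to
  \<open>0\<close> however large \<open>c\<close> is.\<close>

lemma summable_gaussian_nat:
  fixes c q :: real
  assumes "0 < q" "q < 1" "0 < c"
  shows "summable (\<lambda>n. c ^ n * q ^ (2 * n * n))"
proof -
  have "(\<lambda>n. c * q\<^sup>2 * (q ^ 4) ^ n) \<longlonglongrightarrow> c * q\<^sup>2 * 0"
    using assms by (intro tendsto_intros LIMSEQ_realpow_zero) (auto simp: power_less_one_iff)
  then have "eventually (\<lambda>n. c * q\<^sup>2 * (q ^ 4) ^ n < 1 / 2) sequentially"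
    by (rule order_tendstoD) simp
  then obtain n0 where n0: "\<And>n. n \<ge> n0 \<Longrightarrow> c * q\<^sup>2 * (q ^ 4) ^ n < 1 / 2"
    by (auto simp: eventually_sequentially)
  show ?thesis
  proof (rule summable_ratio_test[where c = "1 / 2" and N = n0])
    fix n assume "n0 \<le> n"
    have "c ^ Suc n * q ^ (2 * Suc n * Suc n) = (c * q\<^sup>2 * (q ^ 4) ^ n) * (c ^ n * q ^ (2 * n * n))"
      by (simp add: power_add[symmetric] power_mult[symmetric] algebra_simps)
    also have "\<dots> \<le> 1 / 2 * (c ^ n * q ^ (2 * n * n))"
      using n0[OF \<open>n0 \<le> n\<close>] assms by (intro mult_right_mono) auto
    finally show "norm (c ^ Suc n * q ^ (2 * Suc n * Suc n)) \<le> 1 / 2 * norm (c ^ n * q ^ (2 * n * n))"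
      using assms by simp
  qed simp
qed

text \<open>Reflecting \<open>j\<close> to \<open>-j\<close> replaces \<open>c\<close> by its
  inverse and keeps the Gaussian factor, so both half-lines reduce to the natural numbers.\<close>

lemma summable_on_gaussian_int:
  fixes c q :: real
  assumes "0 < q" "q < 1" "0 < c"
  shows "(\<lambda>j. c powi j * q powi (2 * j * j)) summable_on UNIV"
proof -
  let ?f = "\<lambda>j. c powi j * q powi (2 * j * j)"
  have nn: "(\<lambda>n. d ^ n * q ^ (2 * n * n)) summable_on UNIV" if "d > 0" for d :: real
    using summable_gaussian_nat[OF assms(1,2) that] assms that
    by (subst summable_on_UNIV_nonneg_real_iff) auto
  have pow: "q powi (2 * int n * int n) = q ^ (2 * n * n)" for n
    by (metis of_nat_mult of_nat_numeral power_int_of_nat)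
  have "?f \<circ> int = (\<lambda>n. c ^ n * q ^ (2 * n * n))"
    using pow by (auto simp: fun_eq_iff)
  then have "?f summable_on range int"
    using nn[OF assms(3)] by (subst summable_on_reindex) auto
  then have 1: "?f summable_on {0..}"
    by (rule summable_on_subset_banach) (metis UNIV_I atLeast_iff image_eqI nonneg_int_cases subsetI)
  have "?f \<circ> (\<lambda>n. - int n) = (\<lambda>n. inverse c ^ n * q ^ (2 * n * n))"
    using pow by (auto simp: fun_eq_iff power_int_minus power_inverse)
  then have "?f summable_on range (\<lambda>n. - int n)"
    using nn[of "inverse c"] assms by (subst summable_on_reindex) (auto simp: inj_on_def)
  then have 2: "?f summable_on {..<0}"
  proof (rule summable_on_subset_banach)
    show "{..<0} \<subseteq> range (\<lambda>n. - int n)"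
    proof
      fix x :: int assume "x \<in> {..<0}"
      then have "x = - int (nat (- x))" by simp
      then show "x \<in> range (\<lambda>n. - int n)" by blast
    qed
  qed
  have "?f summable_on ({0..} \<union> {..<0})"
    using 1 2 by (rule summable_on_Un_disjoint) auto
  moreover have "{0..} \<union> {..<0} = (UNIV :: int set)" by auto
  ultimately show ?thesis by simp
qed

text \<open>This is \<open>\<theta>(t)\<^sup>2 / \<theta>(t q\<^sup>j)\<^sup>2\<close> for the theta function with nome \<open>sqrt q\<close>, see \<open>F_fun_mult_cnj\<close>.\<close>
definition vweight :: "real \<Rightarrow> real \<Rightarrow> int \<Rightarrow> real" where
  "vweight q t j = t powi (4 * j) * q powi (2 * j * j - j)"

lemma vweight_add_one:
  assumes "0 < q" "0 < t"
  shows "vweight q t (j + 1) = q * (t * q powi j) ^ 4 * vweight q t j"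
proof -
  have "2 * (j + 1) * (j + 1) - (j + 1) = (2 * j * j - j) + 4 * j + 1"
    by (simp add: algebra_simps)
  then have "q powi (2 * (j + 1) * (j + 1) - (j + 1)) = q powi (2 * j * j - j) * q powi (4 * j) * q"
    using assms power_int_add[of q "2 * j * j - j + 4 * j" 1] power_int_add[of q "2 * j * j - j" "4 * j"]
    by (simp only:) simp
  moreover have "q powi (4 * j) = (q powi j) ^ 4"
    using power_int_mult[of q j 4] by (simp add: mult.commute)
  moreover have "t powi (4 * (j + 1)) = t powi (4 * j) * t ^ 4"
    using assms power_int_add[of t "4 * j" 4] by (simp add: distrib_left)
  ultimately show ?thesis
    unfolding vweight_def by (simp add: power_mult_distrib)
qed

text \<open>Every factor besides \<open>q powi (2 * j * j)\<close> has an exponent at most linear in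
  \<open>j\<close>, so up to a constant it is absorbed into the base \<open>c\<close> of a Gaussian
  series.\<close>

lemma summable_on_vweight_power:
  assumes "0 < q" "q < 1" "0 < t"
  shows "(\<lambda>j. vweight q t j * (t * q powi j) powi s) summable_on UNIV"
proof -
  define c where "c = t ^ 4 * q powi (s - 1)"
  have "vweight q t j * (t * q powi j) powi s = t powi s * (c powi j * q powi (2 * j * j))" for j
  proof -
    have "2 * j * j - j + j * s = (s - 1) * j + 2 * j * j" by (simp add: algebra_simps)
    then have "q powi (2 * j * j - j) * q powi (j * s) = q powi ((s - 1) * j) * q powi (2 * j * j)"
      using assms by (metis power_int_add less_irrefl)
    moreover have "(t ^ 4) powi j = t powi (4 * j)"
      using power_int_mult[of t 4 j] by simp
    ultimately show ?thesis
      by (simp add: vweight_def c_def power_int_mult_distrib power_int_mult[symmetric])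
  qed
  moreover have "c > 0" using assms by (simp add: c_def)
  ultimately show ?thesis
    using summable_on_gaussian_int[OF assms(1,2)] by (simp add: summable_on_cmult_right)
qed

lemma summable_on_sum_real:
  fixes f :: "'a \<Rightarrow> 'b \<Rightarrow> real"
  assumes "\<And>k. k \<in> K \<Longrightarrow> (\<lambda>x. f x k) summable_on A"
  shows "(\<lambda>x. \<Sum>k\<in>K. f x k) summable_on A"
  using assms by (induction K rule: infinite_finite_induct) (auto intro!: summable_on_add)

text \<open>Apart from the weight, the summand is a Laurent polynomial in
  \<open>z = t * q powi j\<close>, so it splits into finitely many weighted powers of
  \<open>z\<close>.\<close>

lemma summable_on_hweight:
  assumes q: "0 < q" "q < 1" and t: "0 < t"
  shows "(\<lambda>j. (1 + (t * q powi j)\<^sup>2) * vweight q t j * hpoly q M (t * q powi j) * hpoly q N (t * q powi j))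
    summable_on UNIV"
proof -
  have expand: "(1 + z\<^sup>2) * v * hpoly q M z * hpoly q N z =
    (\<Sum>k\<in>{0..M}. \<Sum>l\<in>{0..N}. hcoef q M k * hcoef q N l *
      (v * z powi (2 * k - M + (2 * l - N)) + v * z powi (2 * k - M + (2 * l - N) + 2)))" if "z \<noteq> 0" for z v
  proof -
    have "hpoly q M z * hpoly q N z = 
      (\<Sum>k\<in>{0..M}. \<Sum>l\<in>{0..N}. hcoef q M k * hcoef q N l * z powi (2 * k - M + (2 * l - N)))"
      using that unfolding hpoly_def sum_product by (simp add: power_int_add mult_ac)
    then have "(1 + z\<^sup>2) * v * (hpoly q M z * hpoly q N z) = 
      (\<Sum>k\<in>{0..M}. \<Sum>l\<in>{0..N}. (1 + z\<^sup>2) * v * (hcoef q M k * hcoef q N l * z powi (2 * k - M + (2 * l - N))))"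
      by (simp only: sum_distrib_left)
    also have "\<dots> = (\<Sum>k\<in>{0..M}. \<Sum>l\<in>{0..N}. hcoef q M k * hcoef q N l *
      (v * z powi (2 * k - M + (2 * l - N)) + v * z powi (2 * k - M + (2 * l - N) + 2)))"
    proof (intro sum.cong refl)
      fix k l
      have "z powi (2 * k - M + (2 * l - N) + 2) = z powi (2 * k - M + (2 * l - N)) * z\<^sup>2"
        using that power_int_add[of z "2 * k - M + (2 * l - N)" 2] by simp
      then show "(1 + z\<^sup>2) * v * (hcoef q M k * hcoef q N l * z powi (2 * k - M + (2 * l - N))) =
        hcoef q M k * hcoef q N l *
        (v * z powi (2 * k - M + (2 * l - N)) + v * z powi (2 * k - M + (2 * l - N) + 2))"
        by (simp only:) (simp only: algebra_simps)
    qed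
    finally show ?thesis by (simp add: mult.assoc)
  qed
  have nz: "t * q powi j \<noteq> 0" for j using q t by simp
  show ?thesis
    unfolding expand[OF nz]
    by (intro summable_on_sum_real summable_on_cmult_right summable_on_add summable_on_vweight_power[OF assms])
qed

section \<open>Orthogonality of the polynomials on a geometric lattice\<close>

lemma hpoly_has_sum_0:
  assumes q: "0 < q" "q < 1" and t: "0 < t" and N: "N \<ge> 1"
  shows "((\<lambda>j. (1 + (t * q powi j)\<^sup>2) * vweight q t j * hpoly q N (t * q powi j)) has_sum 0) UNIV"
proof -
  define H where "H j = vweight q t j * hraise q N (t * q powi j)" for j
  have "H j = (\<Sum>k\<in>{0..N - 1}. (hcoef q (N - 1) k * q powi (-k)) * (vweight q t j * (t * q powi j) powi (2 * k - N)))" for j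
    unfolding H_def hraise_def by (simp add: sum_distrib_left mult_ac)
  then have "H = (\<lambda>j. \<Sum>k\<in>{0..N - 1}. (hcoef q (N - 1) k * q powi (-k)) * (vweight q t j * (t * q powi j) powi (2 * k - N)))" ..
  then have "H summable_on UNIV"
    by (simp only:) (intro summable_on_sum_real summable_on_cmult_right summable_on_vweight_power[OF q t])
  then obtain S where S: "(H has_sum S) UNIV" by (auto simp: summable_on_def)
  \<comment> \<open>The shift is a bijection of the integers, so the telescoping sum leaves no
    boundary terms.\<close>
  have "bij_betw (\<lambda>j::int. j + 1) UNIV UNIV"
    by (rule bij_betwI[where g = "\<lambda>j. j - 1"]) auto
  then have S': "((\<lambda>j. H (j + 1)) has_sum S) UNIV"
    using S has_sum_reindex_bij_betw by blast
  have D: "((\<lambda>j. H j - H (j + 1)) has_sum S - S) UNIV"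
    using has_sum_add[OF S has_sum_cmult_right[OF S', of "-1"]] by simp
  \<comment> \<open>Here \<open>N \<ge> 1\<close> enters: the raising relation can be divided by
    this factor.\<close>
  have n1: "1 - q powi N \<noteq> 0"
  proof -
    have "nat N = Suc (nat (N - 1))" using N by simp
    then have "q powi N = q ^ Suc (nat (N - 1))" using N by (simp only: power_int_def) simp
    moreover have "q ^ Suc (nat (N - 1)) < 1" using q by (intro power_Suc_less_one) auto
    ultimately show ?thesis by simp
  qed
  have "(1 + (t * q powi j)\<^sup>2) * vweight q t j * hpoly q N (t * q powi j) = 1 / (1 - q powi N) * (H j - H (j + 1))" for j
  proof -
    define z where "z = t * q powi j"
    have z: "z \<noteq> 0" using q t by (simp add: z_def)
    have z': "t * q powi (j + 1) = q * z" using q by (simp add: z_def power_int_add)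
    have "H j - H (j + 1) = vweight q t j * (hraise q N z - q * z ^ 4 * hraise q N (q * z))"
      unfolding H_def vweight_add_one[OF q(1) t] z' z_def[symmetric] by (simp add: algebra_simps)
    also have "\<dots> = vweight q t j * ((1 - q powi N) * ((1 + z\<^sup>2) * hpoly q N z))"
      by (simp only: hpoly_raising[OF q z])
    finally show ?thesis using n1 by (simp add: z_def)
  qed
  then show ?thesis using has_sum_cmult_right[OF D, of "1 / (1 - q powi N)"] by simp
qed

text \<open>Write \<open>m = l + 1\<close>. The recurrence expresses \<open>P_m\<close> through
  \<open>(1 / z - z) * P_l\<close> and \<open>P_(l-1)\<close>; the multiplier is then moved onto
  \<open>P_N\<close> and expanded there. This leaves the index pairs \<open>(l, N + 1)\<close>,
  \<open>(l, N - 1)\<close> and \<open>(l - 1, N)\<close>, each with a smaller first index that is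
  still below the second. Hence the strong induction on \<open>m\<close> with \<open>N\<close>
  arbitrary.\<close>

lemma hpoly_orthogonal_less:
  assumes q: "0 < q" "q < 1" and t: "0 < t" and "int m < N"
  shows "((\<lambda>j. (1 + (t * q powi j)\<^sup>2) * vweight q t j * hpoly q (int m) (t * q powi j) * hpoly q N (t * q powi j)) has_sum 0) UNIV"
  using \<open>int m < N\<close>
proof (induction m arbitrary: N rule: less_induct)
  case (less m)
  let ?z = "\<lambda>j. t * q powi j"
  define w where "w j = (1 + (?z j)\<^sup>2) * vweight q t j" for j
  show ?case
  proof (cases m)
    case 0
    have "hpoly q 0 z = 1" for z by (simp add: hpoly_def hcoef_def qfac_inv_def qpoch_def)
    then show ?thesis using hpoly_has_sum_0[OF q t, of N] less.prems 0 by simp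
  next
    case (Suc l)
    have a: "((\<lambda>j. w j * hpoly q l (?z j) * hpoly q (N + 1) (?z j)) has_sum 0) UNIV"
      and b: "((\<lambda>j. w j * hpoly q l (?z j) * hpoly q (N - 1) (?z j)) has_sum 0) UNIV"
      unfolding w_def using less.IH[of l] less.prems Suc by auto
    \<comment> \<open>For \<open>l = 0\<close> the polynomial of index \<open>-1\<close> is zero by
      the empty-range convention.\<close>
    have c: "((\<lambda>j. w j * hpoly q (int l - 1) (?z j) * hpoly q N (?z j)) has_sum 0) UNIV"
    proof (cases l)
      case 0
      then show ?thesis by (simp add: hpoly_def)
    next
      case (Suc l')
      then show ?thesis unfolding w_def using less.IH[of l'] less.prems \<open>m = Suc l\<close> by auto
    qed
    have l: "1 - q powi (int l + 1) \<noteq> 0"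
    proof -
      have "q ^ Suc l < 1" using q by (intro power_Suc_less_one) auto
      then show ?thesis using q by (auto simp: power_int_add mult.commute)
    qed
    have "w j * hpoly q (int m) (?z j) * hpoly q N (?z j) = 1 / (1 - q powi (int l + 1)) * 
      ((1 - q powi (N + 1)) * (w j * hpoly q l (?z j) * hpoly q (N + 1) (?z j)) +
       q powi (-N) * (w j * hpoly q l (?z j) * hpoly q (N - 1) (?z j)) +
       - (q powi (- int l)) * (w j * hpoly q (int l - 1) (?z j) * hpoly q N (?z j)))" for j
    proof -
      define z where "z = ?z j"
      have z: "z \<noteq> 0" using q t by (simp add: z_def)
      have m: "int m = int l + 1" using Suc by simp
      have 1: "(1 - q powi (int l + 1)) * hpoly q (int l + 1) z =
          (1 / z - z) * hpoly q l z - q powi (- int l) * hpoly q (int l - 1) z"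
        using hpoly_three_term[OF q z, of "int l"] by simp
      have "(1 - q powi (int l + 1)) * (w j * hpoly q (int l + 1) z * hpoly q N z) =
         w j * hpoly q N z * ((1 - q powi (int l + 1)) * hpoly q (int l + 1) z)" by (simp only: mult_ac)
      also have "\<dots> = w j * hpoly q l z * ((1 / z - z) * hpoly q N z)
          - q powi (- int l) * (w j * hpoly q (int l - 1) z * hpoly q N z)"
        unfolding 1 by (simp add: algebra_simps)
      also have "\<dots> = w j * hpoly q l z * ((1 - q powi (N + 1)) * hpoly q (N + 1) z + q powi (-N) * hpoly q (N - 1) z)
          - q powi (- int l) * (w j * hpoly q (int l - 1) z * hpoly q N z)"
        by (simp only: hpoly_three_term[OF q z, of N])
      finally have 2: "(1 - q powi (int l + 1)) * (w j * hpoly q (int l + 1) z * hpoly q N z) = \<dots>" .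
      have "w j * hpoly q (int l + 1) z * hpoly q N z = 1 / (1 - q powi (int l + 1)) *
          ((1 - q powi (int l + 1)) * (w j * hpoly q (int l + 1) z * hpoly q N z))"
        using l by simp
      then show ?thesis unfolding m z_def[symmetric] unfolding 2 by (simp add: algebra_simps)
    qed
    moreover have "((\<lambda>j. 1 / (1 - q powi (int l + 1)) * 
      ((1 - q powi (N + 1)) * (w j * hpoly q l (?z j) * hpoly q (N + 1) (?z j)) +
       q powi (-N) * (w j * hpoly q l (?z j) * hpoly q (N - 1) (?z j)) +
       - (q powi (- int l)) * (w j * hpoly q (int l - 1) (?z j) * hpoly q N (?z j)))) has_sum
       1 / (1 - q powi (int l + 1)) * ((1 - q powi (N + 1)) * 0 + q powi (-N) * 0 + - (q powi (- int l)) * 0)) UNIV"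
      by (intro has_sum_cmult_right has_sum_add a b c)
    ultimately show ?thesis unfolding w_def by simp
  qed
qed

lemma hpoly_orthogonal:
  assumes q: "0 < q" "q < 1" and t: "0 < t" and "m \<noteq> n"
  shows "((\<lambda>j. (1 + (t * q powi j)\<^sup>2) * vweight q t j * hpoly q (int m) (t * q powi j) * hpoly q (int n) (t * q powi j)) has_sum 0) UNIV"
proof (cases "m < n")
  case True
  then show ?thesis using hpoly_orthogonal_less[OF q t, of m "int n"] by simp
next
  case False
  then have "n < m" using \<open>m \<noteq> n\<close> by simp
  then show ?thesis using hpoly_orthogonal_less[OF q t, of n "int m"] by (simp add: mult_ac)
qed

section \<open>Quasi-periodicity of the theta function\<close>

text \<open>Geometric decay of \<open>a * p ^ j\<close> gives absolute convergence, so the infinite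
  product is the limit of its partial products even if some factor vanishes.\<close>

lemma qpoch_inf_LIMSEQ:
  fixes a p :: real
  assumes "0 < p" "p < 1"
  shows "(\<lambda>n. \<Prod>j\<le>n. 1 - a * p ^ j) \<longlonglongrightarrow> qpoch_inf a p"
proof -
  have "summable (\<lambda>j. norm ((1 - a * p ^ j) - 1))"
    using assms by (auto simp: abs_mult intro!: summable_mult summable_geometric)
  then have "convergent_prod (\<lambda>j. 1 - a * p ^ j)"
    by (intro abs_convergent_prod_imp_convergent_prod summable_imp_abs_convergent_prod)
  then show ?thesis unfolding qpoch_inf_def by (rule convergent_prod_LIMSEQ)
qed

lemma qpoch_inf_rec:
  fixes a p :: real
  assumes "0 < p" "p < 1"
  shows "qpoch_inf a p = (1 - a) * qpoch_inf (a * p) p"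
proof (rule LIMSEQ_unique)
  show "(\<lambda>n. \<Prod>j\<le>Suc n. 1 - a * p ^ j) \<longlonglongrightarrow> qpoch_inf a p"
    using qpoch_inf_LIMSEQ[OF assms] by (rule LIMSEQ_Suc)
  have "(\<lambda>n. (1 - a) * (\<Prod>j\<le>n. 1 - a * p * p ^ j)) \<longlonglongrightarrow> (1 - a) * qpoch_inf (a * p) p"
    using qpoch_inf_LIMSEQ[OF assms] by (intro tendsto_intros)
  then show "(\<lambda>n. \<Prod>j\<le>Suc n. 1 - a * p ^ j) \<longlonglongrightarrow> (1 - a) * qpoch_inf (a * p) p"
    by (subst prod.atMost_Suc_shift) (simp add: mult.assoc)
qed

text \<open>Passing from \<open>z\<close> to \<open>z * p\<close> removes the factor
  \<open>1 - z\<close> from the first product and adds \<open>1 - 1 / z\<close> to the second; their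
  quotient is \<open>- 1 / z\<close>. At \<open>z = 1\<close>, where this quotient is undefined,
  both sides are zero.\<close>

lemma theta_quasi_periodic:
  fixes p z :: real
  assumes p: "0 < p" "p < 1" and z: "z \<noteq> 0"
  shows "theta p (z * p) = - theta p z / z"
proof (cases "z = 1")
  case True
  have "qpoch_inf 1 p = 0" using qpoch_inf_rec[OF p, of 1] by simp
  then show ?thesis using True p by (simp add: theta_def)
next
  case False
  have "theta p (z * p) = qpoch_inf (z * p) p * qpoch_inf (1 / z) p"
    using p by (simp add: theta_def)
  also have "qpoch_inf (1 / z) p = (1 - 1 / z) * qpoch_inf (p / z) p"
    using qpoch_inf_rec[OF p, of "1 / z"] by simp
  finally show ?thesis
    using False z by (simp add: theta_def qpoch_inf_rec[OF p, of z] field_simps)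
qed

text \<open>Quasi-periodicity is iterated \<open>m\<close> times; the nome powers with exponents
  \<open>0, ..., m - 1\<close> multiply to \<open>q powr (m * (m - 1) / 4)\<close>. Stating it for
  reciprocals covers zeros of theta as well, since both sides are then \<open>0\<close>.\<close>

lemma inverse_theta_shift:
  fixes q z :: real
  assumes q: "0 < q" "q < 1" and z: "0 < z"
  shows "1 / theta (sqrt q) (z * sqrt q powi m) =
    (-1) powi m * z powi m * q powr (real_of_int (m * (m - 1)) / 4) / theta (sqrt q) z"
proof -
  define R where "R m = (-1) powi m * z powi m * q powr (real_of_int (m * (m - 1)) / 4) / theta (sqrt q) z" for m :: int
  define T where "T m = 1 / theta (sqrt q) (z * sqrt q powi m)" for m :: int
  have s: "0 < sqrt q" "sqrt q < 1" using q by auto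
  have Rs: "R (m + 1) = - (z * sqrt q powi m) * R m" for m
  proof -
    have "real_of_int ((m + 1) * (m + 1 - 1)) / 4 = real_of_int (m * (m - 1)) / 4 + real_of_int m / 2"
      by (simp add: field_simps)
    then have "q powr (real_of_int ((m + 1) * (m + 1 - 1)) / 4) = q powr (real_of_int (m * (m - 1)) / 4) * q powr (real_of_int m / 2)"
      by (simp only: powr_add)
    moreover have "sqrt q powi m = q powr (real_of_int m / 2)"
      using q by (simp add: powr_half_sqrt[symmetric] powr_real_of_int'[symmetric] powr_powr)
    ultimately show ?thesis using z unfolding R_def by (simp only:) (simp add: power_int_add)
  qed
  have Ts: "T (m + 1) = - (z * sqrt q powi m) * T m" for m
  proof -
    have "z * sqrt q powi m \<noteq> 0" using z q by simp
    then have "theta (sqrt q) (z * sqrt q powi m * sqrt q) = - theta (sqrt q) (z * sqrt q powi m) / (z * sqrt q powi m)"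
      by (rule theta_quasi_periodic[OF s])
    moreover have "z * sqrt q powi (m + 1) = z * sqrt q powi m * sqrt q"
      using s power_int_add[of "sqrt q" m 1] by (simp add: mult.assoc)
    ultimately show ?thesis unfolding T_def by (simp only:) simp
  qed
  have "T m = R m"
  proof (induction m rule: int_induct[where k = 0])
    case base
    show ?case using q by (simp add: T_def R_def)
  next
    case (step1 i)
    then show ?case by (simp add: Rs Ts)
  next
    case (step2 i)
    \<comment> \<open>Downwards, the common one-step recursion is inverted by cancelling its nonzero
      factor.\<close>
    have "- (z * sqrt q powi (i - 1)) \<noteq> 0" using z q by simp
    moreover have "- (z * sqrt q powi (i - 1)) * R (i - 1) = - (z * sqrt q powi (i - 1)) * T (i - 1)"
      using step2 Rs[of "i - 1"] Ts[of "i - 1"] by simp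
    ultimately show ?case using q by auto
  qed
  then show ?thesis by (simp add: T_def R_def)
qed

section \<open>Expressing the functions through the polynomials\<close>

lemma index_range_half:
  "index_range (real N / 2) = (\<lambda>k. real_of_int k - real N / 2) ` {0..int N}"
proof (intro equalityI subsetI)
  fix i assume i: "i \<in> index_range (real N / 2)"
  then obtain l where l: "real N / 2 - i = of_int l"
    by (auto simp: index_range_def elim: Ints_cases)
  have "0 \<le> l" "l \<le> int N" using i l by (auto simp: index_range_def)
  moreover have "i = real_of_int (int N - l) - real N / 2" using l by simp
  ultimately show "i \<in> (\<lambda>k. real_of_int k - real N / 2) ` {0..int N}" by (intro image_eqI[where x = "int N - l"]) auto
next
  fix i assume "i \<in> (\<lambda>k. real_of_int k - real N / 2) ` {0..int N}"
  then obtain k where k: "i = real_of_int k - real N / 2" "0 \<le> k" "k \<le> int N" by auto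
  have "2 * i = of_int (2 * k - int N)" "real N / 2 - i = of_int (int N - k)" using k by auto
  then have "2 * i \<in> \<int>" "real N / 2 - i \<in> \<int>" by (metis Ints_of_int)+
  then show "i \<in> index_range (real N / 2)" using k by (auto simp: index_range_def half_ints_def)
qed

text \<open>With \<open>k = n + i\<close>, each theta value is a nome shift of
  \<open>theta (sqrt q) (z x)\<close>, so its reciprocal factors out of the sum, and the remaining
  coefficients are those of \<open>hpoly\<close>.\<close>

lemma F_fun_eq_hpoly:
  assumes q: "0 < q" "q < 1" and t: "0 < t"
  defines "z \<equiv> \<lambda>x. t * q powr x"
  shows "F_fun q (\<i> * complex_of_real t) (real N / 2) x = complex_of_real
    (- ((-1) ^ N) * q powr ((real N)\<^sup>2 / 4) * sqrt (1 + 1 / (z x)\<^sup>2) * z x / theta (sqrt q) (z x) * hpoly q (int N) (z x))"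
proof -
  have zx: "z x > 0" using q t by (simp add: z_def)
  have "(\<i> * complex_of_real t) powi (-2) = - complex_of_real (1 / t\<^sup>2)"
    by (simp add: power_int_minus power_mult_distrib inverse_eq_divide)
  moreover have "1 / (z x)\<^sup>2 = 1 / t\<^sup>2 * q powr (- 2 * x)"
    using q t by (simp add: z_def power_mult_distrib powr_minus field_simps) (simp add: power2_eq_square mult.commute flip: powr_add)
  ultimately have "1 - (\<i> * complex_of_real t) powi (-2) * complex_of_real (q powr (- 2 * x)) = complex_of_real (1 + 1 / (z x)\<^sup>2)"
    by simp
  then have 1: "csqrt (1 - (\<i> * complex_of_real t) powi (-2) * complex_of_real (q powr (- 2 * x))) = complex_of_real (sqrt (1 + 1 / (z x)\<^sup>2))"
    by (simp only:) (subst csqrt_of_real_nonneg, auto intro: add_nonneg_nonneg)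
  have 2: "(\<Sum>i\<in>index_range (real N / 2).
       (-1) powi \<lfloor>real N / 2 + i\<rfloor> * q powr (- i / 2) /
         (qpoch q q (nat \<lfloor>real N / 2 - i\<rfloor>) * qpoch q q (nat \<lfloor>real N / 2 + i\<rfloor>)) *
       (1 / theta (sqrt q) (t * q powr (x + i + 1 / 2)))) =
     - ((-1) ^ N) * q powr ((real N)\<^sup>2 / 4) * z x / theta (sqrt q) (z x) * hpoly q (int N) (z x)"
  proof -
    have summand: "(-1) powi \<lfloor>real N / 2 + i\<rfloor> * q powr (- i / 2) /
         (qpoch q q (nat \<lfloor>real N / 2 - i\<rfloor>) * qpoch q q (nat \<lfloor>real N / 2 + i\<rfloor>)) *
       (1 / theta (sqrt q) (t * q powr (x + i + 1 / 2))) =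
       - ((-1) ^ N) * q powr ((real N)\<^sup>2 / 4) * z x / theta (sqrt q) (z x) * (hcoef q (int N) k * z x powi (2 * k - int N))"
      if k: "k \<in> {0..int N}" and i: "i = real_of_int k - real N / 2" for k i
    proof -
      \<comment> \<open>Since \<open>i + 1 / 2 = m / 2\<close>, the shift by
        \<open>i + 1 / 2\<close> is the \<open>m\<close>-th power of the nome
        \<open>sqrt q\<close>.\<close>
      define m where "m = 2 * k - int N + 1"
      have f: "\<lfloor>real N / 2 + i\<rfloor> = k" "\<lfloor>real N / 2 - i\<rfloor> = int N - k"
      proof -
        show "\<lfloor>real N / 2 + i\<rfloor> = k" by (simp add: i)
        have "real N / 2 - i = real_of_int (int N - k)" by (simp add: i)
        then show "\<lfloor>real N / 2 - i\<rfloor> = int N - k" by (simp only: floor_of_int)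
      qed
      have "sqrt q powi m = q powr (real_of_int m / 2)"
        using q by (simp add: powr_half_sqrt[symmetric] powr_real_of_int'[symmetric] powr_powr)
      also have "real_of_int m / 2 = i + 1 / 2" by (simp add: m_def i field_simps)
      finally have "t * q powr (x + i + 1 / 2) = z x * sqrt q powi m"
        by (simp add: z_def powr_add mult.assoc)
      then have th: "1 / theta (sqrt q) (t * q powr (x + i + 1 / 2)) =
          (-1) powi m * z x powi m * q powr (real_of_int (m * (m - 1)) / 4) / theta (sqrt q) (z x)"
        using inverse_theta_shift[OF q zx] by simp
      \<comment> \<open>With \<open>m = 2 * i + 1\<close> the linear terms in \<open>i\<close>
        cancel and \<open>i\<^sup>2 = N\<^sup>2 / 4 + k * (k - N)\<close> remains.\<close>
      have e: "q powr (- i / 2) * q powr (real_of_int (m * (m - 1)) / 4) = q powr ((real N)\<^sup>2 / 4) * q powi (k * (k - int N))"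
      proof -
        have "- i / 2 + real_of_int (m * (m - 1)) / 4 = (real N)\<^sup>2 / 4 + real_of_int (k * (k - int N))"
          by (simp add: m_def i field_simps power2_eq_square)
        then have "q powr (- i / 2) * q powr (real_of_int (m * (m - 1)) / 4) =
            q powr ((real N)\<^sup>2 / 4) * q powr real_of_int (k * (k - int N))"
          by (simp only: powr_add[symmetric])
        also have "q powr real_of_int (k * (k - int N)) = q powi (k * (k - int N))"
          using q by (intro powr_real_of_int') auto
        finally show ?thesis .
      qed
      \<comment> \<open>The parity of \<open>m\<close> is that of \<open>N + 1\<close>, so this sign
        does not depend on \<open>k\<close>.\<close>
      have sg: "(-1) powi m = - ((-1) ^ N :: real)"
      proof -
        have "m = 2 * (k - int N) + int (Suc N)" by (simp add: m_def)
        moreover have "(-1 :: real) powi (2 * (k - int N)) = 1"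
          using power_int_mult[of "-1 :: real" 2 "k - int N"] by simp
        ultimately have "(-1 :: real) powi m = (-1) ^ Suc N"
          using power_int_add[of "-1 :: real" "2 * (k - int N)" "int (Suc N)"] by (simp only: power_int_of_nat) simp
        then show ?thesis by simp
      qed
      have zm: "z x powi m = z x * z x powi (2 * k - int N)"
        using zx by (simp add: m_def power_int_add)
      have E: "(-1) powi k * q powr (- i / 2) / (Q1 * Q2) * ((-1) powi m * z x powi m * q powr (real_of_int (m * (m - 1)) / 4) / theta (sqrt q) (z x))
        = (-1) powi k * (-1) powi m * z x powi m * (q powr (- i / 2) * q powr (real_of_int (m * (m - 1)) / 4)) / (Q1 * Q2) / theta (sqrt q) (z x)" for Q1 Q2 :: real
        by simp
      show ?thesis
        unfolding f th E
        unfolding e sg zm hcoef_def qfac_inv_def using k by (simp add: mult_ac)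
    qed
    have inj: "inj_on (\<lambda>k. real_of_int k - real N / 2) {0..int N}" by (auto simp: inj_on_def)
    show ?thesis
      unfolding index_range_half hpoly_def sum_distrib_left sum.reindex[OF inj] o_def
      by (rule sum.cong[OF refl]) (rule summand[OF _ refl])
  qed
  show ?thesis
    unfolding F_fun_def 1 using 2 t by (simp add: norm_mult mult_ac)
qed

text \<open>The values are real, so conjugation acts trivially. The two square roots combine with
  the two factors \<open>z\<close> to \<open>1 + z\<^sup>2\<close>, and the squared reciprocal theta
  value yields \<open>vweight\<close> times a constant of the coset.\<close>

lemma F_fun_mult_cnj:
  assumes q: "0 < q" "q < 1" and t: "0 < t" and u: "u = t * q powr a"
  shows "F_fun q (\<i> * complex_of_real t) (real M / 2) (a + real_of_int j) *
      cnj (F_fun q (\<i> * complex_of_real t) (real N / 2) (a + real_of_int j)) =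
    complex_of_real ((-1) ^ M * (-1) ^ N * q powr ((real M)\<^sup>2 / 4) * q powr ((real N)\<^sup>2 / 4) / (theta (sqrt q) u)\<^sup>2 *
      ((1 + (u * q powi j)\<^sup>2) * vweight q u j * hpoly q (int M) (u * q powi j) * hpoly q (int N) (u * q powi j)))"
proof -
  define z where "z = u * q powi j"
  have u0: "u > 0" and z0: "z > 0" using q t u by (auto simp: z_def)
  have z: "t * q powr (a + real_of_int j) = z"
    using q by (simp add: z_def u powr_add powr_real_of_int')
  \<comment> \<open>An integer step in \<open>x\<close> is two nome steps; the even exponent removes
    the sign.\<close>
  have "z = u * sqrt q powi (2 * j)" using q by (simp add: z_def power_int_mult)
  then have "1 / theta (sqrt q) z = u powi (2 * j) * q powr (real_of_int (2 * j * (2 * j - 1)) / 4) / theta (sqrt q) u"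
    using inverse_theta_shift[OF q u0, of "2 * j"] by (simp add: power_int_mult)
  then have "1 / (theta (sqrt q) z)\<^sup>2 = (u powi (2 * j) * q powr (real_of_int (2 * j * (2 * j - 1)) / 4))\<^sup>2 / (theta (sqrt q) u)\<^sup>2"
    by (metis power_divide power_one)
  also have "(u powi (2 * j) * q powr (real_of_int (2 * j * (2 * j - 1)) / 4))\<^sup>2 = vweight q u j"
  proof -
    have "(u powi (2 * j))\<^sup>2 = u powi (4 * j)" using power_int_mult[of u "2 * j" 2] by (simp add: mult.commute)
    moreover have "(q powr (real_of_int (2 * j * (2 * j - 1)) / 4))\<^sup>2 = q powr (real_of_int (2 * j * j - j))"
      using q by (simp add: power2_eq_square powr_add[symmetric]) (simp add: field_simps)
    moreover have "q powr (real_of_int (2 * j * j - j)) = q powi (2 * j * j - j)"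
      using q by (intro powr_real_of_int') auto
    ultimately show ?thesis by (simp only: vweight_def power_mult_distrib)
  qed
  finally have th: "1 / (theta (sqrt q) z)\<^sup>2 = vweight q u j / (theta (sqrt q) u)\<^sup>2" .
  have sq: "sqrt (1 + 1 / z\<^sup>2) * sqrt (1 + 1 / z\<^sup>2) * z\<^sup>2 = 1 + z\<^sup>2"
    using z0 by (simp add: field_simps)
  have E: "(- ((-1) ^ M) * A * s * z / T * P) * (- ((-1) ^ N) * B * s * z / T * Q) =
      (-1) ^ M * (-1) ^ N * A * B * (1 / T\<^sup>2) * (s * s * z\<^sup>2) * P * Q" for A B s T P Q :: real
    by (simp add: power2_eq_square)
  show ?thesis
    unfolding F_fun_eq_hpoly[OF q t] z complex_cnj_complex_of_real of_real_mult[symmetric]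
    unfolding E sq th z_def[symmetric] by (simp add: mult_ac)
qed

section \<open>Square summability and orthogonality on one coset\<close>

lemma F_fun_ell2_coset:
  assumes q: "0 < q" "q < 1" and t: "0 < t"
  shows "(\<lambda>x. (cmod (F_fun q (\<i> * complex_of_real t) (real N / 2) x))\<^sup>2) summable_on range (\<lambda>j. a + real_of_int j)"
proof -
  define u where "u = t * q powr a"
  have u0: "u > 0" using q t by (simp add: u_def)
  have "(cmod (F_fun q (\<i> * complex_of_real t) (real N / 2) (a + real_of_int j)))\<^sup>2 =
     (-1) ^ N * (-1) ^ N * q powr ((real N)\<^sup>2 / 4) * q powr ((real N)\<^sup>2 / 4) / (theta (sqrt q) u)\<^sup>2 *
      ((1 + (u * q powi j)\<^sup>2) * vweight q u j * hpoly q (int N) (u * q powi j) * hpoly q (int N) (u * q powi j))" for j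
    using F_fun_mult_cnj[OF q t u_def, of N j N] unfolding complex_norm_square[symmetric] of_real_eq_iff .
  then have "(\<lambda>j. (cmod (F_fun q (\<i> * complex_of_real t) (real N / 2) (a + real_of_int j)))\<^sup>2) summable_on UNIV"
    by (simp only:) (intro summable_on_cmult_right summable_on_hweight q u0)
  then show ?thesis
    by (subst summable_on_reindex) (auto simp: inj_on_def o_def)
qed

text \<open>Phrased with \<open>has_sum\<close> so that the sums over two disjoint cosets can be
  added afterwards.\<close>

lemma F_fun_has_sum_coset:
  assumes q: "0 < q" "q < 1" and t: "0 < t" and "M \<noteq> N"
  shows "((\<lambda>x. F_fun q (\<i> * complex_of_real t) (real M / 2) x * cnj (F_fun q (\<i> * complex_of_real t) (real N / 2) x))
    has_sum 0) (range (\<lambda>j. a + real_of_int j))"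
proof -
  define u where "u = t * q powr a"
  have u0: "u > 0" using q t by (simp add: u_def)
  \<comment> \<open>The factor in front of the polynomial summand is independent of
    \<open>j\<close>, so the zero sum carries over to the complex-valued products.\<close>
  note sum0 = has_sum_of_real[OF has_sum_cmult_right[OF hpoly_orthogonal[OF q u0 \<open>M \<noteq> N\<close>]],
      where 'a = complex, unfolded mult_zero_right of_real_0]
  have "((\<lambda>j. F_fun q (\<i> * complex_of_real t) (real M / 2) (a + real_of_int j) *
      cnj (F_fun q (\<i> * complex_of_real t) (real N / 2) (a + real_of_int j))) has_sum 0) UNIV"
    unfolding F_fun_mult_cnj[OF q t u_def] by (rule sum0)
  then show ?thesis
    by (subst has_sum_reindex) (auto simp: inj_on_def o_def)
qed

text \<open>The two closure hypotheses hold for every \<open>S\<close> that is a finite disjoint union of cosets of \<open>\<int>\<close>.\<close>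
lemma orthogonal_family_ell2_F_fun:
  assumes q: "0 < q" "q < 1" and t: "0 < t"
    and summable: "\<And>f :: real \<Rightarrow> real. (\<And>a. f summable_on range (\<lambda>j. a + real_of_int j)) \<Longrightarrow> f summable_on S"
    and has_sum: "\<And>f :: real \<Rightarrow> complex. (\<And>a. (f has_sum 0) (range (\<lambda>j. a + real_of_int j))) \<Longrightarrow> (f has_sum 0) S"
  shows "orthogonal_family_ell2 S {n \<in> half_ints. 0 \<le> n} (F_fun q (\<i> * complex_of_real t))"
proof -
  have half: "\<exists>N::nat. n = real N / 2" if n: "n \<in> {n \<in> half_ints. 0 \<le> n}" for n
  proof -
    from n obtain k where k: "2 * n = of_int k" by (auto simp: half_ints_def elim: Ints_cases)
    then have "n = real (nat k) / 2" using n by auto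
    then show ?thesis ..
  qed
  show ?thesis
    unfolding orthogonal_family_ell2_def ell2_def ell2_inner_def
  proof (intro conjI ballI impI CollectI)
    fix n assume "n \<in> {n \<in> half_ints. 0 \<le> n}"
    then obtain N where N: "n = real N / 2" using half by blast
    show "(\<lambda>x. (cmod (F_fun q (\<i> * complex_of_real t) n x))\<^sup>2) summable_on S"
      unfolding N by (rule summable) (rule F_fun_ell2_coset[OF q t])
  next
    fix m n assume "m \<in> {n \<in> half_ints. 0 \<le> n}" "n \<in> {n \<in> half_ints. 0 \<le> n}" "m \<noteq> n"
    then obtain M N where N: "m = real M / 2" "n = real N / 2" "M \<noteq> N" using half by blast
    show "(\<Sum>\<^sub>\<infinity>x\<in>S. F_fun q (\<i> * complex_of_real t) m x * cnj (F_fun q (\<i> * complex_of_real t) n x)) = 0"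
      unfolding N(1,2) by (intro infsumI has_sum F_fun_has_sum_coset q t N(3))
  qed
qed

section \<open>Decomposing the half-integers into two cosets, and the three spaces\<close>

lemma half_ints_eq: "half_ints = \<int> \<union> (\<lambda>k. k + 1 / 2) ` \<int>"
proof (intro equalityI subsetI)
  fix x assume "x \<in> half_ints"
  then obtain k where k: "2 * x = of_int k" by (auto simp: half_ints_def elim: Ints_cases)
  have "k = 2 * (k div 2) \<or> k = 2 * (k div 2) + 1" by presburger
  then have "x = of_int (k div 2) \<or> x = of_int (k div 2) + 1 / 2"
  proof
    assume "k = 2 * (k div 2)"
    then have "real_of_int k = 2 * of_int (k div 2)" by (metis of_int_mult of_int_numeral)
    then show ?thesis using k by simp
  next
    assume "k = 2 * (k div 2) + 1"
    then have "real_of_int k = 2 * of_int (k div 2) + 1" by (metis of_int_1 of_int_add of_int_mult of_int_numeral)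
    then show ?thesis using k by simp
  qed
  then show "x \<in> \<int> \<union> (\<lambda>k. k + 1 / 2) ` \<int>" by auto
next
  fix x :: real assume "x \<in> \<int> \<union> (\<lambda>k. k + 1 / 2) ` \<int>"
  then show "x \<in> half_ints" by (auto simp: half_ints_def distrib_left)
qed

lemma Ints_disjoint_half: "(\<int> :: real set) \<inter> (\<lambda>k. k + 1 / 2) ` \<int> = {}"
proof -
  have "(of_int i :: real) \<noteq> of_int j + 1 / 2" for i j
  proof
    assume "(of_int i :: real) = of_int j + 1 / 2"
    then have "real_of_int (2 * i) = real_of_int (2 * j + 1)" by simp
    then have "2 * i = 2 * j + 1" by (simp only: of_int_eq_iff)
    then show False by presburger
  qed
  then show ?thesis by (auto elim!: Ints_cases)
qed

theorem propositionA4: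
  fixes q :: real and kappa :: complex
  assumes "0 < q" and "q < 1"
    and "kappa \<in> (\<lambda>t. \<i> * complex_of_real t) ` {0<..}"
  shows "orthogonal_family_ell2 \<int> {n \<in> half_ints. 0 \<le> n} (F_fun q kappa) \<and>
         orthogonal_family_ell2 ((\<lambda>k. k + 1 / 2) ` \<int>) {n \<in> half_ints. 0 \<le> n} (F_fun q kappa) \<and>
         orthogonal_family_ell2 half_ints {n \<in> half_ints. 0 \<le> n} (F_fun q kappa)"
proof -
  obtain t where kappa: "kappa = \<i> * complex_of_real t" and t: "0 < t"
    using assms(3) by auto
  \<comment> \<open>The first two spaces are the single cosets with \<open>a = 0\<close> and
    \<open>a = 1 / 2\<close>; the third is their disjoint union.\<close>
  have Z: "\<int> = range (\<lambda>j. 0 + real_of_int j)" by (simp add: Ints_def)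
  have H: "(\<lambda>k. k + 1 / 2) ` \<int> = range (\<lambda>j. 1 / 2 + real_of_int j)"
    by (simp add: Ints_def image_image add.commute)
  note orth = orthogonal_family_ell2_F_fun[OF assms(1,2) t]
  show ?thesis
    unfolding kappa
  proof (intro conjI)
    show "orthogonal_family_ell2 \<int> {n \<in> half_ints. 0 \<le> n} (F_fun q (\<i> * complex_of_real t))"
      unfolding Z by (rule orth)
    show "orthogonal_family_ell2 ((\<lambda>k. k + 1 / 2) ` \<int>) {n \<in> half_ints. 0 \<le> n} (F_fun q (\<i> * complex_of_real t))"
      unfolding H by (rule orth)
    show "orthogonal_family_ell2 half_ints {n \<in> half_ints. 0 \<le> n} (F_fun q (\<i> * complex_of_real t))"
    proof (rule orth)
      fix f :: "real \<Rightarrow> real"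
      assume f: "\<And>a. f summable_on range (\<lambda>j. a + real_of_int j)"
      show "f summable_on half_ints"
        unfolding half_ints_eq using f[of 0] f[of "1 / 2"] Ints_disjoint_half
        by (intro summable_on_Un_disjoint) (simp_all only: Z[symmetric] H[symmetric])
    next
      fix f :: "real \<Rightarrow> complex"
      assume f: "\<And>a. (f has_sum 0) (range (\<lambda>j. a + real_of_int j))"
      have "(f has_sum 0 + 0) (\<int> \<union> (\<lambda>k. k + 1 / 2) ` \<int>)"
        using f[of 0] f[of "1 / 2"] Ints_disjoint_half
        by (intro has_sum_Un_disjoint) (simp_all only: Z[symmetric] H[symmetric])
      then show "(f has_sum 0) half_ints" by (simp add: half_ints_eq)
    qed
  qed
qed

end
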